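(* Let $\mathrm{vol}$ denote the volume form of $\mathcal{P}_+(G)$ in the Euclidean metric. Then the volume form of $(\mathcal{P}_+(G),g_W)$ satisfies $$d\mathrm{vol}_W=\Pi(\rho)^{-\frac12}\,d\mathrm{vol},\qquad \Pi(\rho):=\prod_{i=1}^{n-1}\lambda_i(\rho),$$ where $\lambda_1(\rho),\dots,\lambda_{n-1}(\rho)$ are the positive eigenvalues of $L(\rho)$, counted with multiplicity.
   Context: $G=(V,E,\omega)$ is a connected, weighted, undirected finite graph with vertex set $V=\{1,\dots,n\}$, edge set $E$ and weights $\omega_{ij}=\omega_{ji}>0$ if $(i,j)\in E$, $\omega_{ij}=0$ otherwise; $N(i)=\{j:(i,j)\in E\}$. For $a\in\mathbb{R}^n$ put $\theta_{ij}(a)=\frac{a_i+a_j}{2}$; the linear weighted Laplacian matrix $L(a)\in\mathbb{R}^{n\times n}$ is the symmetric matrix given by $(L(a)\Phi)(i)=\sum_{j\in N(i)}\omega_{ij}\theta_{ij}(a)(\Phi(i)-\Phi(j))$. $A^\dagger$ is the Moore-Penrose pseudo-inverse. $\mathcal{P}_+(G)=\{\rho\in\mathbb{R}^n:\sum_i\rho_i=1,\ \rho_i>0\}$, with tangent space $T_\rho\mathcal{P}_+(G)=\{\sigma\in\mathbb{R}^n:\sum_i\sigma_i=0\}$, carries the Riemannian metric $g_W(\sigma_1,\sigma_2)=\sigma_1^{\mathsf T}L(\rho)^\dagger\sigma_2$. For $\rho\in\mathcal{P}_+(G)$, $L(\rho)$ is positive semidefinite with simple eigenvalue $0$ (eigenvector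 $u_0=\frac1{\sqrt n}(1,\dots,1)^{\mathsf T}$) and $n-1$ positive eigenvalues. The Euclidean volume form is that of $\mathcal{P}_+(G)$ as a hypersurface of $\mathbb{R}^n$ with the induced Euclidean metric; both volume forms are taken with the orientation of $\mathcal{P}_+(G)$ induced by the normal $u_0$ and the standard orientation of $\mathbb{R}^n$. *)

theory Defs
  imports
    "HOL-Library.FuncSet"
    "Jordan_Normal_Form.Char_Poly"
begin

text \<open>The vertices \<open>1, \<dots>, n\<close> are indexed from \<open>0\<close>, as \<open>{..<n}\<close>. Loops are not excluded; they do not
  contribute to the Laplacian.\<close>

locale connected_weighted_graph =
  fixes n :: nat
    and E :: "(nat \<times> nat) set"
    and \<omega> :: "nat \<Rightarrow> nat \<Rightarrow> real"
  assumes n_pos: "0 < n"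
    and edges: "E \<subseteq> {..<n} \<times> {..<n}"
    and undirected: "sym E"
    and weight_sym: "\<And>i j. i < n \<Longrightarrow> j < n \<Longrightarrow> \<omega> i j = \<omega> j i"
    and weight_pos: "\<And>i j. (i, j) \<in> E \<Longrightarrow> 0 < \<omega> i j"
    and weight_zero: "\<And>i j. i < n \<Longrightarrow> j < n \<Longrightarrow> (i, j) \<notin> E \<Longrightarrow> \<omega> i j = 0"
    and connected: "\<And>i j. i < n \<Longrightarrow> j < n \<Longrightarrow> (i, j) \<in> E\<^sup>*"

definition neighbours :: "(nat \<times> nat) set \<Rightarrow> nat \<Rightarrow> nat set" where
  "neighbours E i = {j. (i, j) \<in> E}"

definition edge_mean :: "real vec \<Rightarrow> nat \<Rightarrow> nat \<Rightarrow> real" where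
  "edge_mean a i j = (a $ i + a $ j) / 2"

definition laplacian ::
    "nat \<Rightarrow> (nat \<times> nat) set \<Rightarrow> (nat \<Rightarrow> nat \<Rightarrow> real) \<Rightarrow> real vec \<Rightarrow> real mat" where
  "laplacian n E \<omega> a = mat n n (\<lambda>(i, j).
     (if i = j then (\<Sum>k\<in>neighbours E i. \<omega> i k * edge_mean a i k) else 0)
     - (if j \<in> neighbours E i then \<omega> i j * edge_mean a i j else 0))"

lemma laplacian_mult_vec:
  assumes "E \<subseteq> {..<n} \<times> {..<n}" and "\<Phi> \<in> carrier_vec n" and "i < n"
  shows "(laplacian n E \<omega> a *\<^sub>v \<Phi>) $ i =
    (\<Sum>j\<in>neighbours E i. \<omega> i j * edge_mean a i j * (\<Phi> $ i - \<Phi> $ j))"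
proof -
  let ?N = "neighbours E i" and ?c = "\<lambda>j. \<omega> i j * edge_mean a i j"
  have sub: "?N \<subseteq> {0..<n}"
    using assms(1) by (auto simp: neighbours_def)
  have "(laplacian n E \<omega> a *\<^sub>v \<Phi>) $ i =
      (\<Sum>j\<in>{0..<n}. (if i = j then sum ?c ?N * \<Phi> $ i else 0)
                   - (if j \<in> ?N then ?c j * \<Phi> $ j else 0))"
    using assms(2,3) unfolding laplacian_def
    by (auto simp: scalar_prod_def algebra_simps intro!: sum.cong)
  also have "\<dots> = sum ?c ?N * \<Phi> $ i - (\<Sum>j\<in>{0..<n} \<inter> ?N. ?c j * \<Phi> $ j)"
    using assms(3) by (simp add: sum_subtractf sum.inter_restrict)
  also have "{0..<n} \<inter> ?N = ?N"
    using sub by blast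
  finally show ?thesis
    by (simp add: sum_distrib_right sum_subtractf right_diff_distrib)
qed

text \<open>The Moore--Penrose pseudo-inverse of a real matrix, by the four Penrose equations.\<close>

definition pseudo_inverse :: "real mat \<Rightarrow> real mat" where
  "pseudo_inverse A = (THE B. B \<in> carrier_mat (dim_col A) (dim_row A)
     \<and> A * B * A = A
     \<and> B * A * B = B
     \<and> transpose_mat (A * B) = A * B
     \<and> transpose_mat (B * A) = B * A)"

definition positive_simplex :: "nat \<Rightarrow> real vec set" where
  "positive_simplex n = {\<rho> \<in> carrier_vec n. (\<Sum>i<n. \<rho> $ i) = 1 \<and> (\<forall>i<n. 0 < \<rho> $ i)}"

definition tangent_space :: "nat \<Rightarrow> real vec set" where
  "tangent_space n = {\<sigma> \<in> carrier_vec n. (\<Sum>i<n. \<sigma> $ i) = 0}"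

text \<open>A metric assigns to each point a bilinear form on tangent vectors.\<close>

definition euclidean_metric :: "real vec \<Rightarrow> real vec \<Rightarrow> real vec \<Rightarrow> real" where
  "euclidean_metric \<rho> \<sigma> \<tau> = \<sigma> \<bullet> \<tau>"

definition wasserstein_metric ::
    "nat \<Rightarrow> (nat \<times> nat) set \<Rightarrow> (nat \<Rightarrow> nat \<Rightarrow> real) \<Rightarrow> real vec \<Rightarrow> real vec \<Rightarrow> real vec \<Rightarrow> real" where
  "wasserstein_metric n E \<omega> \<rho> \<sigma> \<tau> = \<sigma> \<bullet> (pseudo_inverse (laplacian n E \<omega> \<rho>) *\<^sub>v \<tau>)"

definition unit_normal :: "nat \<Rightarrow> real vec" where
  "unit_normal n = vec n (\<lambda>_. 1 / sqrt (real n))"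

text \<open>The orientation of the tangent space induced by the normal: \<open>(\<sigma>\<^sub>1, \<dots>, \<sigma>\<^sub>n\<^sub>-\<^sub>1)\<close> is positive iff
  \<open>(u\<^sub>0, \<sigma>\<^sub>1, \<dots>, \<sigma>\<^sub>n\<^sub>-\<^sub>1)\<close> is a positive basis of the ambient space.\<close>

definition positively_oriented :: "nat \<Rightarrow> real vec list \<Rightarrow> bool" where
  "positively_oriented n \<sigma>s \<longleftrightarrow> 0 < det (mat_of_cols n (unit_normal n # \<sigma>s))"

definition tuples :: "'a set \<Rightarrow> nat \<Rightarrow> 'a list set" where
  "tuples T m = {xs. set xs \<subseteq> T \<and> length xs = m}"

text \<open>Forms take a list of \<open>m\<close> vectors of \<open>T\<close>; extensionality makes a form unique as a HOL function.\<close>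

definition alternating_form :: "real vec set \<Rightarrow> nat \<Rightarrow> (real vec list \<Rightarrow> real) \<Rightarrow> bool" where
  "alternating_form T m w \<longleftrightarrow>
     w \<in> extensional (tuples T m)
     \<and> (\<forall>xs\<in>tuples T m. \<forall>i<m. \<forall>y\<in>T. \<forall>z\<in>T. \<forall>c.
          w (xs[i := c \<cdot>\<^sub>v y + z]) = c * w (xs[i := y]) + w (xs[i := z]))
     \<and> (\<forall>xs\<in>tuples T m. \<forall>i<m. \<forall>j<m. i \<noteq> j \<longrightarrow> xs ! i = xs ! j \<longrightarrow> w xs = 0)"

definition orthonormal_wrt :: "(real vec \<Rightarrow> real vec \<Rightarrow> real) \<Rightarrow> real vec list \<Rightarrow> bool" where
  "orthonormal_wrt h es \<longleftrightarrow>
     (\<forall>i<length es. \<forall>j<length es. h (es ! i) (es ! j) = (if i = j then 1 else 0))"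

text \<open>The Riemannian volume form at \<open>\<rho>\<close> of a metric \<open>g\<close> on the positive simplex: the alternating form
  of top degree \<open>n - 1\<close> with value \<open>1\<close> on every positively oriented orthonormal basis. That the
  \<open>n - 1\<close> vectors form a basis of the tangent space is implied by the positive determinant.\<close>

definition volume_form ::
    "nat \<Rightarrow> (real vec \<Rightarrow> real vec \<Rightarrow> real vec \<Rightarrow> real) \<Rightarrow> real vec \<Rightarrow> real vec list \<Rightarrow> real" where
  "volume_form n g \<rho> = (THE w. alternating_form (tangent_space n) (n - 1) w
     \<and> (\<forall>es\<in>tuples (tangent_space n) (n - 1).
          orthonormal_wrt (g \<rho>) es \<longrightarrow> positively_oriented n es \<longrightarrow> w es = 1))"

text \<open>The exponent \<^term>\<open>order l (char_poly A)\<close> is the multiplicity of the eigenvalue \<open>l\<close>.\<close>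

definition prod_positive_eigenvalues :: "real mat \<Rightarrow> real" where
  "prod_positive_eigenvalues A =
     (\<Prod>l\<in>{l. eigenvalue A l \<and> 0 < l}. l ^ order l (char_poly A))"

end

theory Submission
  imports Defs "Jordan_Normal_Form.Schur_Decomposition"
begin

text \<open>Write \<open>L\<close> for the Laplacian at \<open>\<rho>\<close>, \<open>u\<^sub>0\<close> for the unit normal, \<open>m = n - 1\<close> for the dimension of the
  simplex and \<open>(u\<^sub>0 | \<sigma>s)\<close> for the matrix with columns \<open>u\<^sub>0, \<sigma>\<^sub>1, \<dots>, \<sigma>\<^sub>m\<close>.

  Alternating forms of top degree on the tangent space form a line, spanned by
  \<open>\<sigma>s \<mapsto> det (u\<^sub>0 | \<sigma>s)\<close>; that a form is determined by its value on one basis is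
  \<open>alternating_forms_agree\<close>. So a volume form is this determinant times a constant, and the constant
  is found by evaluating on an orthonormal basis. Suppose that the metric is \<open>\<sigma> \<bullet> P \<tau>\<close> on tangent vectors,
  for a symmetric matrix \<open>P\<close> on the whole space that fixes \<open>u\<^sub>0\<close>. For an orthonormal basis \<open>es\<close>, the
  matrix \<open>X = (u\<^sub>0 | es)\<close> satisfies \<open>X\<^sup>T P X = 1\<close>, whence \<open>(det X)\<^sup>2 det P = 1\<close>, and the constant is
  \<open>sqrt (det P)\<close> (\<open>volume_form_eq_normal_det\<close>).

  For the Euclidean metric \<open>P\<close> is the identity. For the Wasserstein metric \<open>P\<close> is the pseudo-inverse
  of \<open>L\<close> plus the projection onto \<open>u\<^sub>0\<close>. By the spectral theorem and connectedness of the graph, \<open>L\<close>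
  has an orthonormal eigenbasis that starts with \<open>u\<^sub>0\<close>, of eigenvalue \<open>0\<close>, and has positive
  eigenvalues \<open>\<lambda>\<^sub>1, \<dots>, \<lambda>\<^sub>m\<close> otherwise (\<open>laplacian_spectral_decomposition\<close>). In this basis \<open>P\<close> is diagonal with
  entries \<open>1, 1 / \<lambda>\<^sub>1, \<dots>, 1 / \<lambda>\<^sub>m\<close>, so \<open>det P\<close> is the inverse of the product of the positive
  eigenvalues.\<close>

section \<open>The spectral theorem for real symmetric matrices\<close>

text \<open>A complex eigenvalue exists by the fundamental theorem of algebra. It is real because, for an
  eigenvector \<open>v\<close> and \<open>s = conjugate v \<bullet> v \<noteq> 0\<close>, both \<open>cnj a * s\<close> and \<open>a * s\<close> equal
  \<open>conjugate v \<bullet> C v\<close>, as symmetry lets \<open>C\<close> act on either side.\<close>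

lemma symmetric_matrix_has_real_eigenvalue:
  fixes A :: "real mat"
  assumes A: "A \<in> carrier_mat n n" and sym: "transpose_mat A = A" and n: "0 < n"
  shows "\<exists>e. eigenvalue A e"
proof -
  define C where "C = map_mat complex_of_real A"
  have C: "C \<in> carrier_mat n n" and Csym: "transpose_mat C = C"
    using A sym by (auto simp: C_def map_mat_transpose)
  obtain as where as: "char_poly C = (\<Prod>a\<leftarrow>as. [:- a, 1:])" "length as = n"
    using char_poly_factorized[OF C] by blast
  then obtain a where "a \<in> set as"
    using n by (metis hd_in_set length_0_conv less_numeral_extra(3))
  then have root: "poly (char_poly C) a = 0"
    unfolding as(1) poly_prod_list by (auto simp: prod_list_zero_iff)
  then obtain v where v: "v \<in> carrier_vec n" "v \<noteq> 0\<^sub>v n" and ev: "C *\<^sub>v v = a \<cdot>\<^sub>v v"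
    using eigenvalue_root_char_poly[OF C] C unfolding eigenvalue_def eigenvector_def by auto
  have cv: "conjugate v \<in> carrier_vec n"
    using v by simp
  have conj_ev: "C *\<^sub>v conjugate v = cnj a \<cdot>\<^sub>v conjugate v"
  proof (rule eq_vecI)
    fix i assume "i < dim_vec (cnj a \<cdot>\<^sub>v conjugate v)"
    then have i: "i < n" using v by simp
    have "(C *\<^sub>v conjugate v) $ i = cnj ((C *\<^sub>v v) $ i)"
      using i v A by (auto simp: C_def scalar_prod_def)
    then show "(C *\<^sub>v conjugate v) $ i = (cnj a \<cdot>\<^sub>v conjugate v) $ i"
      using i v by (simp add: ev)
  qed (use C v in auto)
  have "cnj a * (conjugate v \<bullet> v) = (C *\<^sub>v conjugate v) \<bullet> v"
    using v by (simp add: conj_ev)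
  also have "\<dots> = conjugate v \<bullet> (C *\<^sub>v v)"
    using transpose_vec_mult_scalar[OF C v(1) cv] by (simp add: Csym)
  also have "\<dots> = a * (conjugate v \<bullet> v)"
    using v by (simp add: ev)
  finally have "cnj a = a"
    using v conjugate_square_eq_0_vec[OF v(1)] comm_scalar_prod[OF v(1) cv] by auto
  then have "a = complex_of_real (Re a)"
    by (auto simp: complex_eq_iff)
  moreover have "poly (char_poly C) (complex_of_real x) = complex_of_real (poly (char_poly A) x)" for x
    unfolding C_def of_real_hom.char_poly_hom[OF A] by simp
  ultimately have "poly (char_poly A) (Re a) = 0"
    using root by (metis of_real_eq_0_iff)
  then show ?thesis
    using eigenvalue_root_char_poly[OF A] by blast
qed

text \<open>Gram--Schmidt keeps the direction of the first vector, so it is applied to a basis completing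
  \<open>v\<close> and the results are normalized.\<close>

lemma orthogonal_matrix_with_first_column:
  fixes v :: "real vec"
  assumes v: "v \<in> carrier_vec n" and unit: "v \<bullet> v = 1"
  shows "\<exists>U\<in>carrier_mat n n. transpose_mat U * U = 1\<^sub>m n \<and> col U 0 = v"
proof -
  interpret cof_vec_space n "TYPE(real)" .
  have v0: "v \<noteq> 0\<^sub>v n"
    using unit v by auto
  then have n: "0 < n"
    using v by (cases n) auto
  define b where "b = basis_completion v"
  note b = basis_completion[OF v v0, folded b_def]
  define ws where "ws = gram_schmidt n b"
  note ws = gram_schmidt_result[OF b(2) b(4) b(5) ws_def]
  have len: "length ws = n"
    using ws(4) b(6) by simp
  have wsc: "ws ! i \<in> carrier_vec n" if "i < n" for i
    using ws(3) that len by (metis nth_mem subsetD)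
  have "b = v # tl b"
    using b(6,7) n by (metis length_0_conv list.collapse less_numeral_extra(3))
  then have "hd ws = v"
    unfolding ws_def using gram_schmidt_hd[OF v] by metis
  then have first: "ws ! 0 = v"
    using len n by (metis hd_conv_nth length_0_conv less_numeral_extra(3))
  have orth: "ws ! i \<bullet> ws ! j = 0 \<longleftrightarrow> i \<noteq> j" if "i < n" "j < n" for i j
    using corthogonalD[OF ws(2), of i j] that len by simp
  define s where "s i = sqrt (ws ! i \<bullet> ws ! i)" for i
  have pos: "0 < ws ! i \<bullet> ws ! i" if "i < n" for i
  proof -
    have "0 \<le> ws ! i \<bullet> ws ! i"
      by (simp add: scalar_prod_def sum_nonneg)
    then show ?thesis
      using orth[OF that that] by linarith
  qed
  define U where "U = mat n n (\<lambda>(k, i). ws ! i $ k / s i)"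
  have "transpose_mat U * U = 1\<^sub>m n"
  proof (rule eq_matI)
    fix i j assume "i < dim_row (1\<^sub>m n :: real mat)" "j < dim_col (1\<^sub>m n :: real mat)"
    then have ij: "i < n" "j < n" by auto
    have "(transpose_mat U * U) $$ (i, j) = (\<Sum>k<n. ws ! i $ k / s i * (ws ! j $ k / s j))"
      using ij by (simp add: U_def scalar_prod_def atLeast0LessThan)
    also have "\<dots> = (\<Sum>k<n. ws ! i $ k * ws ! j $ k) / (s i * s j)"
      by (simp add: sum_divide_distrib)
    also have "(\<Sum>k<n. ws ! i $ k * ws ! j $ k) = ws ! i \<bullet> ws ! j"
      using wsc[OF ij(2)] by (simp add: scalar_prod_def atLeast0LessThan)
    finally show "(transpose_mat U * U) $$ (i, j) = 1\<^sub>m n $$ (i, j)"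
      using ij orth[OF ij] pos[of i] by (auto simp: s_def)
  qed (auto simp: U_def)
  moreover have "col U 0 = v"
    using n v first unit by (intro eq_vecI) (auto simp: U_def s_def)
  moreover have "U \<in> carrier_mat n n"
    by (simp add: U_def)
  ultimately show ?thesis by blast
qed

lemma index_triple_product:
  fixes P :: "real mat"
  assumes "P \<in> carrier_mat n n" "M \<in> carrier_mat n n" "i < n" "j < n"
  shows "(transpose_mat M * P * M) $$ (i, j) = col M i \<bullet> (P *\<^sub>v col M j)"
proof -
  have "(transpose_mat M * P * M) $$ (i, j) = (transpose_mat M * (P * M)) $$ (i, j)"
    using assms by (simp add: assoc_mult_mat[of _ n n _ n _ n])
  also have "\<dots> = col M i \<bullet> col (P * M) j"
    using assms by simp
  finally show ?thesis
    using assms by (simp add: col_mult2[of P n n M n] del: col_mult)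
qed

lemma transpose_triple_product:
  fixes A :: "real mat"
  assumes "A \<in> carrier_mat n n" "V \<in> carrier_mat n n" "transpose_mat A = A"
  shows "transpose_mat (transpose_mat V * A * V) = transpose_mat V * A * V"
  using assms transpose_mult[of "transpose_mat V * A" n n V n] transpose_mult[of "transpose_mat V" n n A n]
  by (simp add: assoc_mult_mat[of _ n n _ n _ n])

text \<open>The induction step of the spectral theorem, with control of the first column. In an orthonormal
  basis that starts with \<open>v\<close>, symmetry makes the matrix block diagonal with blocks \<open>e\<close> and \<open>B\<close>, and
  an orthogonal \<open>W\<close> that diagonalizes \<open>B\<close> acts on the basis vectors other than \<open>v\<close>.\<close>

lemma split_off_eigenvector:
  fixes A :: "real mat"
  assumes A: "A \<in> carrier_mat (Suc m) (Suc m)" and sym: "transpose_mat A = A"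
    and v: "v \<in> carrier_vec (Suc m)" "v \<bullet> v = 1" and ev: "A *\<^sub>v v = e \<cdot>\<^sub>v v"
    and diag: "\<And>B :: real mat. B \<in> carrier_mat m m \<Longrightarrow> transpose_mat B = B \<Longrightarrow>
      \<exists>W\<in>carrier_mat m m. \<exists>g. transpose_mat W * W = 1\<^sub>m m \<and> transpose_mat W * B * W = mat_diag m g"
  shows "\<exists>U\<in>carrier_mat (Suc m) (Suc m). \<exists>f. transpose_mat U * U = 1\<^sub>m (Suc m) \<and>
    transpose_mat U * A * U = mat_diag (Suc m) f \<and> col U 0 = v \<and> f 0 = e"
proof -
  let ?n = "Suc m"
  note assoc = assoc_mult_mat[of _ ?n ?n _ ?n _ ?n]
  obtain V where V: "V \<in> carrier_mat ?n ?n" and VV: "transpose_mat V * V = 1\<^sub>m ?n"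
    and V0: "col V 0 = v"
    using orthogonal_matrix_with_first_column[OF v] by blast
  define C where "C = transpose_mat V * A * V"
  have C: "C \<in> carrier_mat ?n ?n"
    using V A by (simp add: C_def)
  have Csym: "transpose_mat C = C"
    unfolding C_def by (rule transpose_triple_product[OF A V sym])
  have C0: "C $$ (i, 0) = (if i = 0 then e else 0)" if i: "i < ?n" for i
  proof -
    have "C $$ (i, 0) = (transpose_mat V * (A * V)) $$ (i, 0)"
      using V A by (simp add: C_def assoc)
    also have "\<dots> = col V i \<bullet> col (A * V) 0"
      using V A i by simp
    also have "col (A * V) 0 = e \<cdot>\<^sub>v v"
      using V A by (simp add: V0[symmetric] ev[symmetric, unfolded V0[symmetric]] col_mult2[of A ?n ?n V ?n] del: col_mult)
    also have "col V i \<bullet> (e \<cdot>\<^sub>v v) = e * (transpose_mat V * V) $$ (i, 0)"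
      using V i v by (simp add: V0)
    finally show ?thesis
      using i by (simp add: VV)
  qed
  have C0': "C $$ (0, i) = (if i = 0 then e else 0)" if "i < ?n" for i
    using C0[OF that] C that by (subst Csym[symmetric]) simp
  define B where "B = mat m m (\<lambda>(i, j). C $$ (Suc i, Suc j))"
  have B: "B \<in> carrier_mat m m"
    by (simp add: B_def)
  have "transpose_mat B = B"
  proof (rule eq_matI)
    fix i j assume "i < dim_row B" "j < dim_col B"
    then show "transpose_mat B $$ (i, j) = B $$ (i, j)"
      using C by (simp add: B_def) (subst Csym[symmetric], simp)
  qed (auto simp: B_def)
  then obtain W g where W: "W \<in> carrier_mat m m" and WW: "transpose_mat W * W = 1\<^sub>m m"
    and WBW: "transpose_mat W * B * W = mat_diag m g"
    using diag[OF B] by blast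
  define E where "E = mat_diag 1 (\<lambda>_. e)"
  have E: "E \<in> carrier_mat 1 1"
    by (simp add: E_def)
  have block: "C = four_block_mat E (0\<^sub>m 1 m) (0\<^sub>m m 1) B"
    using C C0 C0' by (intro eq_matI) (auto simp: E_def mat_diag_def B_def)
  define Z where "Z = four_block_mat (1\<^sub>m 1) (0\<^sub>m 1 m) (0\<^sub>m m 1) W"
  have Z: "Z \<in> carrier_mat ?n ?n"
    using four_block_carrier_mat[of "1\<^sub>m 1" 1 1 W m m] W by (simp add: Z_def)
  have Zt: "transpose_mat Z = four_block_mat (1\<^sub>m 1) (0\<^sub>m 1 m) (0\<^sub>m m 1) (transpose_mat W)"
    unfolding Z_def using W by (subst transpose_four_block_mat[of _ 1 1 _ m _ m]) auto
  have Wt: "transpose_mat W \<in> carrier_mat m m"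
    using W by simp
  have ZZ: "transpose_mat Z * Z = 1\<^sub>m ?n"
    unfolding Zt unfolding Z_def
    using W Wt WW by (subst mult_four_block_mat[of _ 1 1 _ m _ m _ _ 1 _ m]) (auto intro!: eq_matI)
  have "transpose_mat Z * C = four_block_mat E (0\<^sub>m 1 m) (0\<^sub>m m 1) (transpose_mat W * B)"
    unfolding Zt block using W Wt E B
    by (subst mult_four_block_mat[of _ 1 1 _ m _ m _ _ 1 _ m]) auto
  then have "transpose_mat Z * C * Z =
      four_block_mat E (0\<^sub>m 1 m) (0\<^sub>m m 1) (transpose_mat W * B) * four_block_mat (1\<^sub>m 1) (0\<^sub>m 1 m) (0\<^sub>m m 1) W"
    by (simp add: Z_def)
  also have "\<dots> = four_block_mat E (0\<^sub>m 1 m) (0\<^sub>m m 1) (mat_diag m g)"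
    using W Wt E B
    by (subst mult_four_block_mat[of _ 1 1 _ m _ m _ _ 1 _ m]) (auto simp: WBW[symmetric])
  also have "\<dots> = mat_diag ?n (case_nat e g)"
    by (intro eq_matI) (auto simp: E_def mat_diag_def split: nat.split)
  finally have ZCZ: "transpose_mat Z * C * Z = mat_diag ?n (case_nat e g)" .
  define U where "U = V * Z"
  have U: "U \<in> carrier_mat ?n ?n"
    using V Z by (simp add: U_def)
  have Ut: "transpose_mat U = transpose_mat Z * transpose_mat V"
    unfolding U_def by (rule transpose_mult[OF V Z])
  have Zt_c: "transpose_mat Z \<in> carrier_mat ?n ?n" and Vt_c: "transpose_mat V \<in> carrier_mat ?n ?n"
    using Z V by auto
  have "transpose_mat U * U = transpose_mat Z * ((transpose_mat V * V) * Z)"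
    unfolding Ut unfolding U_def using V Z Zt_c Vt_c by (simp add: assoc)
  then have "transpose_mat U * U = 1\<^sub>m ?n"
    using VV ZZ Z by simp
  moreover have "transpose_mat U * A * U = transpose_mat Z * C * Z"
    unfolding Ut C_def unfolding U_def using V Z A Zt_c Vt_c by (simp add: assoc)
  moreover have "col U 0 = v"
  proof -
    have "col Z 0 = unit_vec ?n 0"
      using W by (intro eq_vecI) (auto simp: Z_def unit_vec_def)
    then have "col U 0 = V *\<^sub>v unit_vec ?n 0"
      unfolding U_def using V Z by (simp add: col_mult2[of V ?n ?n Z ?n] del: col_mult)
    also have "\<dots> = v"
      using V V0 v by (intro eq_vecI) auto
    finally show ?thesis .
  qed
  ultimately show ?thesis
    using U ZCZ by (intro bexI[of _ U] exI[of _ "case_nat e g"]) auto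
qed

lemma eigenvector_normalize:
  fixes A :: "real mat"
  assumes A: "A \<in> carrier_mat n n" and e: "eigenvalue A e"
  shows "\<exists>v\<in>carrier_vec n. v \<bullet> v = 1 \<and> A *\<^sub>v v = e \<cdot>\<^sub>v v"
proof -
  obtain w where w: "w \<in> carrier_vec n" "w \<noteq> 0\<^sub>v n" "A *\<^sub>v w = e \<cdot>\<^sub>v w"
    using e A unfolding eigenvalue_def eigenvector_def by auto
  have "0 < w \<bullet> w"
    using conjugate_square_greater_0_vec[OF w(1)] w(2) by simp
  then have "(1 / sqrt (w \<bullet> w) \<cdot>\<^sub>v w) \<bullet> (1 / sqrt (w \<bullet> w) \<cdot>\<^sub>v w) = 1"
    using w(1) by simp
  moreover have "A *\<^sub>v (1 / sqrt (w \<bullet> w) \<cdot>\<^sub>v w) = e \<cdot>\<^sub>v (1 / sqrt (w \<bullet> w) \<cdot>\<^sub>v w)"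
    using w A by (simp add: mult_mat_vec[OF A w(1)] smult_smult_assoc mult.commute)
  ultimately show ?thesis
    using w(1) by (intro bexI[of _ "1 / sqrt (w \<bullet> w) \<cdot>\<^sub>v w"]) auto
qed

lemma symmetric_matrix_diagonalizable:
  fixes A :: "real mat"
  assumes "A \<in> carrier_mat n n" and "transpose_mat A = A"
  shows "\<exists>U\<in>carrier_mat n n. \<exists>f. transpose_mat U * U = 1\<^sub>m n \<and> transpose_mat U * A * U = mat_diag n f"
  using assms
proof (induction n arbitrary: A)
  case 0
  then show ?case
    by (intro bexI[of _ "1\<^sub>m 0"] exI[of _ "\<lambda>_. 0"]) (auto simp: mat_diag_def intro!: eq_matI)
next
  case (Suc m)
  obtain e where "eigenvalue A e"
    using symmetric_matrix_has_real_eigenvalue[OF Suc.prems] by auto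
  then obtain v where "v \<in> carrier_vec (Suc m)" "v \<bullet> v = 1" "A *\<^sub>v v = e \<cdot>\<^sub>v v"
    using eigenvector_normalize[OF Suc.prems(1)] by blast
  from split_off_eigenvector[OF Suc.prems this Suc.IH] show ?case
    by blast
qed

text \<open>The first column is prescribed since the Laplacian is diagonalized below in a basis that starts
  with the unit normal of the simplex.\<close>

lemma spectral_theorem_with_eigenvector:
  fixes A :: "real mat"
  assumes A: "A \<in> carrier_mat n n" and sym: "transpose_mat A = A"
    and v: "v \<in> carrier_vec n" "v \<bullet> v = 1" and ev: "A *\<^sub>v v = e \<cdot>\<^sub>v v"
  shows "\<exists>U\<in>carrier_mat n n. \<exists>f. transpose_mat U * U = 1\<^sub>m n \<and>
    A = U * mat_diag n f * transpose_mat U \<and> col U 0 = v \<and> f 0 = e"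
proof (cases n)
  case 0
  then show ?thesis
    using v by (auto simp: scalar_prod_def)
next
  case (Suc m)
  from split_off_eigenvector[OF A[unfolded Suc] sym v[unfolded Suc] ev symmetric_matrix_diagonalizable]
  obtain U f where U: "U \<in> carrier_mat n n" and UU: "transpose_mat U * U = 1\<^sub>m n"
    and D: "transpose_mat U * A * U = mat_diag n f" and f: "col U 0 = v" "f 0 = e"
    unfolding Suc by blast
  have Ut: "transpose_mat U \<in> carrier_mat n n"
    using U by simp
  have UU': "U * transpose_mat U = 1\<^sub>m n"
    by (rule mat_mult_left_right_inverse[OF Ut U UU])
  have "U * mat_diag n f * transpose_mat U = (U * transpose_mat U) * A * (U * transpose_mat U)"
    unfolding D[symmetric] using U Ut A by (simp add: assoc_mult_mat[of _ n n _ n _ n])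
  then have "A = U * mat_diag n f * transpose_mat U"
    using A by (simp add: UU')
  with U UU f show ?thesis
    by blast
qed

section \<open>Matrices given by an orthonormal eigenbasis and eigenvalues\<close>

text \<open>Two solutions \<open>B\<close>, \<open>C\<close> of the Penrose equations agree: transposing \<open>A B = (A C) (A B)\<close> gives
  \<open>A B = A C\<close>, likewise \<open>B A = C A\<close>, and then \<open>C = C A C = B A C = B A B = B\<close>.\<close>

lemma pseudo_inverse_eqI:
  assumes A: "A \<in> carrier_mat nr nc" and B: "B \<in> carrier_mat nc nr"
    and eqs: "A * B * A = A" "B * A * B = B"
    and syms: "transpose_mat (A * B) = A * B" "transpose_mat (B * A) = B * A"
  shows "pseudo_inverse A = B"
  unfolding pseudo_inverse_def
proof (rule the_equality)
  show "B \<in> carrier_mat (dim_col A) (dim_row A) \<and> A * B * A = A \<and> B * A * B = B \<and>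
      transpose_mat (A * B) = A * B \<and> transpose_mat (B * A) = B * A"
    using assms by auto
next
  fix C assume "C \<in> carrier_mat (dim_col A) (dim_row A) \<and> A * C * A = A \<and> C * A * C = C \<and>
      transpose_mat (A * C) = A * C \<and> transpose_mat (C * A) = C * A"
  then have C: "C \<in> carrier_mat nc nr" and eqs': "A * C * A = A" "C * A * C = C"
    and syms': "transpose_mat (A * C) = A * C" "transpose_mat (C * A) = C * A"
    using A by auto
  have AB: "A * B \<in> carrier_mat nr nr" and AC: "A * C \<in> carrier_mat nr nr"
    and BA: "B * A \<in> carrier_mat nc nc" and CA: "C * A \<in> carrier_mat nc nc"
    using A B C by auto
  have "A * B = (A * C) * (A * B)"
    using assoc_mult_mat[OF AC A B] eqs'(1) by simp
  then have "A * B = (A * B) * (A * C)"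
    using transpose_mult[OF AC AB] syms(1) syms'(1) by simp
  also have "\<dots> = A * C"
    using assoc_mult_mat[OF AB A C] eqs(1) by simp
  finally have left: "A * B = A * C" .
  have "B * A = (B * A) * (C * A)"
    using assoc_mult_mat[OF B A CA] assoc_mult_mat[OF A C A] eqs'(1) by simp
  then have "B * A = (C * A) * (B * A)"
    using transpose_mult[OF BA CA] syms(2) syms'(2) by simp
  also have "\<dots> = C * A"
    using assoc_mult_mat[OF C A BA] assoc_mult_mat[OF A B A] eqs(1) by simp
  finally have right: "B * A = C * A" .
  have "C = (C * A) * C"
    using eqs'(2) by simp
  also have "\<dots> = B * (A * C)"
    using assoc_mult_mat[OF B A C] by (simp add: right)
  also have "\<dots> = B"
    using assoc_mult_mat[OF B A B] eqs(2) by (simp add: left)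
  finally show "C = B" .
qed

lemma transpose_mat_diag: "transpose_mat (mat_diag n f) = mat_diag n f"
  by (rule eq_matI) (auto simp: mat_diag_def)

lemma det_mat_diag: "det (mat_diag n f) = (\<Prod>i<n. f i :: real)"
proof -
  have "det (mat_diag n f) = prod_list (diag_mat (mat_diag n f))"
    by (rule det_upper_triangular[OF _ mat_diag_dim]) (auto simp: mat_diag_def)
  also have "\<dots> = (\<Prod>i<n. f i)"
    by (simp add: prod_list_diag_prod mat_diag_def atLeast0LessThan)
  finally show ?thesis .
qed

definition from_spectrum :: "real mat \<Rightarrow> (nat \<Rightarrow> real) \<Rightarrow> real mat" where
  "from_spectrum U f = U * mat_diag (dim_row U) f * transpose_mat U"

locale orthogonal_matrix =
  fixes n :: nat and U :: "real mat"
  assumes U: "U \<in> carrier_mat n n" and orthonormal_columns: "transpose_mat U * U = 1\<^sub>m n"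
begin

lemma U_transpose_carrier: "transpose_mat U \<in> carrier_mat n n"
  using U by simp

lemma orthonormal_rows: "U * transpose_mat U = 1\<^sub>m n"
  by (rule mat_mult_left_right_inverse[OF U_transpose_carrier U orthonormal_columns])

lemma factor_carriers:
  "U * mat_diag n f \<in> carrier_mat n n" "mat_diag n f * transpose_mat U \<in> carrier_mat n n"
  "U * (mat_diag n f * transpose_mat U) \<in> carrier_mat n n"
  using mult_carrier_mat[OF U mat_diag_dim] mult_carrier_mat[OF mat_diag_dim U_transpose_carrier]
    mult_carrier_mat[OF U mult_carrier_mat[OF mat_diag_dim U_transpose_carrier]] by auto

lemma from_spectrum_factors: "from_spectrum U f = U * (mat_diag n f * transpose_mat U)"
  using U assoc_mult_mat[OF U mat_diag_dim U_transpose_carrier] by (simp add: from_spectrum_def)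

lemma from_spectrum_carrier: "from_spectrum U f \<in> carrier_mat n n"
  unfolding from_spectrum_factors by (rule factor_carriers)

lemma diagonalize_from_spectrum: "transpose_mat U * from_spectrum U f * U = mat_diag n f"
proof -
  have "transpose_mat U * from_spectrum U f = (transpose_mat U * U) * (mat_diag n f * transpose_mat U)"
    unfolding from_spectrum_factors by (rule assoc_mult_mat[OF U_transpose_carrier U factor_carriers(2), symmetric])
  also have "\<dots> = mat_diag n f * transpose_mat U"
    unfolding orthonormal_columns by (rule left_mult_one_mat[OF factor_carriers(2)])
  finally show ?thesis
    using assoc_mult_mat[OF mat_diag_dim U_transpose_carrier U, of f] right_mult_one_mat[OF mat_diag_dim, of n f]
    by (simp add: orthonormal_columns)
qed

lemma from_spectrum_mult: "from_spectrum U f * from_spectrum U g = from_spectrum U (\<lambda>i. f i * g i)"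
proof -
  have "mat_diag n f * transpose_mat U * from_spectrum U g =
      mat_diag n f * (transpose_mat U * from_spectrum U g)"
    by (rule assoc_mult_mat[OF mat_diag_dim U_transpose_carrier from_spectrum_carrier])
  also have "transpose_mat U * from_spectrum U g = (transpose_mat U * U) * (mat_diag n g * transpose_mat U)"
    unfolding from_spectrum_factors by (rule assoc_mult_mat[OF U_transpose_carrier U factor_carriers(2), symmetric])
  also have "\<dots> = mat_diag n g * transpose_mat U"
    unfolding orthonormal_columns by (rule left_mult_one_mat[OF factor_carriers(2)])
  also have "mat_diag n f * (mat_diag n g * transpose_mat U) =
      mat_diag n (\<lambda>i. f i * g i) * transpose_mat U"
    using assoc_mult_mat[OF mat_diag_dim[of n f] mat_diag_dim[of n g] U_transpose_carrier] by simp
  finally show ?thesis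
    using assoc_mult_mat[OF U factor_carriers(2) from_spectrum_carrier, of f g]
    by (simp add: from_spectrum_factors)
qed

lemma transpose_from_spectrum: "transpose_mat (from_spectrum U f) = from_spectrum U f"
proof -
  have "transpose_mat (from_spectrum U f) = U * mat_diag n f * transpose_mat U"
    unfolding from_spectrum_factors
    by (simp only: transpose_mult[OF U factor_carriers(2)] transpose_mult[OF mat_diag_dim U_transpose_carrier]
        transpose_mat_diag transpose_transpose)
  then show ?thesis
    using U by (simp only: from_spectrum_def carrier_matD)
qed

text \<open>A zero eigenvalue is kept at zero, as it must be, by the convention \<open>inverse 0 = 0\<close>.\<close>

lemma pseudo_inverse_from_spectrum:
  "pseudo_inverse (from_spectrum U f) = from_spectrum U (\<lambda>i. inverse (f i))"
proof -
  have "x * inverse x * x = x" "inverse x * x * inverse x = inverse x" for x :: real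
    by (cases "x = 0"; simp)+
  then show ?thesis
    by (intro pseudo_inverse_eqI[OF from_spectrum_carrier from_spectrum_carrier])
       (simp_all only: from_spectrum_mult transpose_from_spectrum)
qed

lemma similar_from_spectrum: "similar_mat (from_spectrum U f) (mat_diag n f)"
  unfolding similar_mat_def
  using U U_transpose_carrier orthonormal_columns orthonormal_rows from_spectrum_carrier[of f]
  by (intro exI[of _ U] exI[of _ "transpose_mat U"] similar_mat_witI[of _ _ n]) (auto simp: from_spectrum_def)

lemma det_from_spectrum: "det (from_spectrum U f) = (\<Prod>i<n. f i)"
  using det_similar[OF similar_from_spectrum] by (simp add: det_mat_diag)

lemma char_poly_from_spectrum: "char_poly (from_spectrum U f) = (\<Prod>i<n. [:- f i, 1:])"
proof -
  have "char_poly (from_spectrum U f) = char_poly (mat_diag n f)"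
    by (rule char_poly_similar[OF similar_from_spectrum])
  also have "\<dots> = (\<Prod>a\<leftarrow>diag_mat (mat_diag n f). [:- a, 1:])"
    by (rule char_poly_upper_triangular[OF mat_diag_dim]) (auto simp: mat_diag_def)
  also have "diag_mat (mat_diag n f) = map f [0..<n]"
    by (auto simp: diag_mat_def mat_diag_def)
  also have "(\<Prod>a\<leftarrow>map f [0..<n]. [:- a, 1:]) = (\<Prod>i<n. [:- f i, 1:])"
    by (simp add: prod.distinct_set_conv_list[symmetric] o_def atLeast0LessThan)
  finally show ?thesis .
qed

text \<open>The algebraic multiplicity of \<open>l\<close> is the number of indices \<open>i\<close> with \<open>f i = l\<close>, so the product over
  the distinct positive eigenvalues regroups into a product over indices.\<close>

lemma prod_positive_eigenvalues_from_spectrum: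
  "prod_positive_eigenvalues (from_spectrum U f) = (\<Prod>i | i < n \<and> 0 < f i. f i)"
proof -
  let ?A = "from_spectrum U f" and ?I = "{i. i < n \<and> 0 < f i}"
  have ev: "eigenvalue ?A l \<longleftrightarrow> l \<in> f ` {..<n}" for l
    unfolding eigenvalue_root_char_poly[OF from_spectrum_carrier] char_poly_from_spectrum
    by (auto simp: poly_prod)
  have "Polynomial.order l (\<Prod>i<m. [:- f i, 1:]) = card {i. i < m \<and> f i = l}" for l m
  proof (induction m)
    case 0
    then show ?case by (simp add: order_0I)
  next
    case (Suc m)
    have "(\<Prod>i<m. [:- f i, 1:]) * [:- f m, 1:] \<noteq> 0"
      unfolding mult_eq_0_iff by simp
    then have "Polynomial.order l (\<Prod>i<Suc m. [:- f i, 1:]) =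
        Polynomial.order l (\<Prod>i<m. [:- f i, 1:]) + Polynomial.order l [:- f m, 1:]"
      unfolding prod.lessThan_Suc by (rule order_mult)
    also have "\<dots> = card {i. i < m \<and> f i = l} + (if f m = l then 1 else 0)"
      by (simp add: Suc.IH order_linear')
    finally have step: "Polynomial.order l (\<Prod>i<Suc m. [:- f i, 1:]) =
        card {i. i < m \<and> f i = l} + (if f m = l then 1 else 0)" .
    have "{i. i < Suc m \<and> f i = l} = {i. i < m \<and> f i = l} \<union> (if f m = l then {m} else {})"
      by (auto simp: less_Suc_eq)
    then have "card {i. i < Suc m \<and> f i = l} = card {i. i < m \<and> f i = l} + (if f m = l then 1 else 0)"
      by (simp add: card_insert_if)
    then show ?case
      by (simp only: step)
  qed
  then have ord: "Polynomial.order l (char_poly ?A) = card {i. i < n \<and> f i = l}" for l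
    by (simp add: char_poly_from_spectrum)
  have "{l. eigenvalue ?A l \<and> 0 < l} = f ` ?I"
    by (auto simp: ev)
  then have "prod_positive_eigenvalues ?A = (\<Prod>l\<in>f ` ?I. l ^ card {i. i < n \<and> f i = l})"
    by (simp add: prod_positive_eigenvalues_def ord)
  also have "\<dots> = (\<Prod>l\<in>f ` ?I. \<Prod>i | i \<in> ?I \<and> f i = l. f i)"
  proof (rule prod.cong[OF refl])
    fix l assume "l \<in> f ` ?I"
    then have "{i. i < n \<and> f i = l} = {i. i \<in> ?I \<and> f i = l}"
      by auto
    then show "l ^ card {i. i < n \<and> f i = l} = (\<Prod>i | i \<in> ?I \<and> f i = l. f i)"
      by simp
  qed
  also have "\<dots> = (\<Prod>i\<in>?I. f i)"
    by (rule prod.image_gen[symmetric]) simp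
  finally show ?thesis .
qed

text \<open>Eigenvalues of eigenvectors orthogonal to \<open>x\<close> do not influence the image of \<open>x\<close>. This allows a
  metric on the tangent space to be written with a matrix whose action on the normal is chosen
  freely.\<close>

lemma from_spectrum_mult_vec_cong:
  assumes x: "x \<in> carrier_vec n" and eq: "\<And>i. i < n \<Longrightarrow> col U i \<bullet> x \<noteq> 0 \<Longrightarrow> f i = g i"
  shows "from_spectrum U f *\<^sub>v x = from_spectrum U g *\<^sub>v x"
proof -
  have expand: "from_spectrum U h *\<^sub>v x = U *\<^sub>v (mat_diag n h *\<^sub>v (transpose_mat U *\<^sub>v x))" for h
    using U U_transpose_carrier x by (simp add: from_spectrum_def assoc_mult_mat_vec[of _ n n _ n])
  have diag: "(mat_diag n h *\<^sub>v (transpose_mat U *\<^sub>v x)) $ i = h i * (col U i \<bullet> x)" if i: "i < n" for h i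
  proof -
    have "(mat_diag n h *\<^sub>v (transpose_mat U *\<^sub>v x)) $ i =
        (\<Sum>j<n. (if i = j then h j else 0) * (col U j \<bullet> x))"
      using U i x by (simp add: scalar_prod_def mat_diag_def atLeast0LessThan)
    also have "\<dots> = (\<Sum>j<n. if j = i then h i * (col U i \<bullet> x) else 0)"
      by (rule sum.cong) auto
    finally show ?thesis
      using i by simp
  qed
  have "mat_diag n f *\<^sub>v (transpose_mat U *\<^sub>v x) = mat_diag n g *\<^sub>v (transpose_mat U *\<^sub>v x)"
  proof (rule eq_vecI)
    fix i assume "i < dim_vec (mat_diag n g *\<^sub>v (transpose_mat U *\<^sub>v x))"
    then have i: "i < n" by (simp add: mat_diag_def)
    show "(mat_diag n f *\<^sub>v (transpose_mat U *\<^sub>v x)) $ i = (mat_diag n g *\<^sub>v (transpose_mat U *\<^sub>v x)) $ i"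
      unfolding diag[OF i] using eq[OF i] by auto
  qed (simp add: mat_diag_def)
  then show ?thesis
    by (simp add: expand)
qed

end

section \<open>Alternating forms of top degree on the tangent space\<close>

text \<open>The cofactors along column \<open>i\<close> do not involve that column, so the Laplace expansion is linear in
  it.\<close>

lemma det_mat_of_cols_linear:
  fixes y z :: "real vec"
  assumes "length vs = n" and i: "i < n" and "y \<in> carrier_vec n" "z \<in> carrier_vec n"
  shows "det (mat_of_cols n (vs[i := c \<cdot>\<^sub>v y + z])) =
    c * det (mat_of_cols n (vs[i := y])) + det (mat_of_cols n (vs[i := z]))"
proof -
  have minor: "cofactor (mat_of_cols n (vs[i := x])) k i = cofactor (mat_of_cols n vs) k i" for x k
  proof -
    have "mat_delete (mat_of_cols n (vs[i := x])) k i = mat_delete (mat_of_cols n vs) k i"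
      using assms(1) by (intro eq_matI) (auto simp: mat_delete_def mat_of_cols_def)
    then show ?thesis
      by (simp add: cofactor_def)
  qed
  have "det (mat_of_cols n (vs[i := x])) = (\<Sum>k<n. x $ k * cofactor (mat_of_cols n vs) k i)" for x
    using assms(1) i
    by (subst laplace_expansion_column[of _ n i]) (auto simp: minor mat_of_cols_index intro!: carrier_matI)
  then show ?thesis
    using assms by (simp add: algebra_simps sum.distrib sum_distrib_left)
qed

lemma tangent_space_combine:
  "y \<in> tangent_space n \<Longrightarrow> z \<in> tangent_space n \<Longrightarrow> c \<cdot>\<^sub>v y + z \<in> tangent_space n"
  by (auto simp: tangent_space_def sum.distrib sum_distrib_left[symmetric])

lemma tangent_space_zero: "0\<^sub>v n \<in> tangent_space n"
  by (auto simp: tangent_space_def)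

lemma tuples_update: "xs \<in> tuples T m \<Longrightarrow> y \<in> T \<Longrightarrow> xs[i := y] \<in> tuples T m"
  using set_update_subset_insert[of xs i y] by (auto simp: tuples_def)

text \<open>Up to extensionality, this is the Euclidean volume form of the hyperplane orthogonal to the unit
  normal. Every top-degree alternating form on the tangent space is a multiple of it.\<close>

definition normal_det :: "nat \<Rightarrow> real vec list \<Rightarrow> real" where
  "normal_det n xs = det (mat_of_cols n (unit_normal n # xs))"

lemma normal_det_alternating:
  "alternating_form (tangent_space n) (n - 1)
     (restrict (\<lambda>xs. a * normal_det n xs) (tuples (tangent_space n) (n - 1)))"
proof -
  let ?T = "tangent_space n"
  have "normal_det n (xs[i := c \<cdot>\<^sub>v y + z]) = c * normal_det n (xs[i := y]) + normal_det n (xs[i := z])"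
    if "xs \<in> tuples ?T (n - 1)" "i < n - 1" "y \<in> ?T" "z \<in> ?T" for xs i y z c
    using that det_mat_of_cols_linear[of "unit_normal n # xs" n "Suc i" y z c]
    by (auto simp: normal_det_def tuples_def tangent_space_def)
  moreover have "normal_det n xs = 0"
    if "xs \<in> tuples ?T (n - 1)" "i < n - 1" "j < n - 1" "i \<noteq> j" "xs ! i = xs ! j" for xs i j
  proof -
    have "xs ! j \<in> carrier_vec n"
      using that by (metis (mono_tags, lifting) mem_Collect_eq nth_mem subsetD tangent_space_def tuples_def)
    then show ?thesis
      using that unfolding normal_det_def
      by (intro det_identical_columns[of _ n "Suc i" "Suc j"]) (auto simp: tuples_def intro!: carrier_matI)
  qed
  ultimately show ?thesis
    by (auto simp: alternating_form_def tuples_update tangent_space_combine algebra_simps)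
qed

lemma alternating_form_linear:
  assumes "alternating_form T m w" "xs \<in> tuples T m" "i < m" "y \<in> T" "z \<in> T"
  shows "w (xs[i := c \<cdot>\<^sub>v y + z]) = c * w (xs[i := y]) + w (xs[i := z])"
  using assms by (simp add: alternating_form_def)

lemma alternating_form_repeated:
  assumes "alternating_form T m w" "xs \<in> tuples T m" "\<not> distinct xs"
  shows "w xs = 0"
  using assms by (auto simp: alternating_form_def tuples_def distinct_conv_nth)

text \<open>Put \<open>a + b\<close> in both places \<open>i\<close> and \<open>j\<close>, where \<open>a\<close>, \<open>b\<close> are the entries there: the value is \<open>0\<close>, and
  expanding it leaves only the two mixed terms.\<close>

lemma alternating_form_swap:
  assumes w: "alternating_form (tangent_space n) m w" and xs: "xs \<in> tuples (tangent_space n) m"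
    and ij: "i < m" "j < m" "i \<noteq> j"
  shows "w (xs[i := xs ! j, j := xs ! i]) = - w xs"
proof -
  let ?T = "tangent_space n"
  define F where "F p q = w (xs[i := p, j := q])" for p q
  have len: "length xs = m"
    using xs by (simp add: tuples_def)
  have T: "xs ! i \<in> ?T" "xs ! j \<in> ?T"
    using xs ij len by (auto simp: tuples_def)
  have one: "1 \<cdot>\<^sub>v p = p" for p :: "real vec"
    by auto
  have add: "p + q \<in> ?T" if "p \<in> ?T" "q \<in> ?T" for p q
    using tangent_space_combine[OF that, of 1] by (simp add: one)
  have right: "F p (q + r) = F p q + F p r" if "p \<in> ?T" "q \<in> ?T" "r \<in> ?T" for p q r
    using alternating_form_linear[OF w tuples_update[OF xs that(1)] ij(2) that(2,3), of i 1]
    by (simp add: F_def one)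
  have left: "F (q + r) p = F q p + F r p" if "p \<in> ?T" "q \<in> ?T" "r \<in> ?T" for p q r
    using alternating_form_linear[OF w tuples_update[OF xs that(1)] ij(1) that(2,3), of j 1] ij
    by (simp add: F_def one list_update_swap)
  have same: "F p p = 0" if "p \<in> ?T" for p
    unfolding F_def
  proof (rule alternating_form_repeated[OF w tuples_update[OF tuples_update[OF xs]]])
    show "\<not> distinct (xs[i := p, j := p])"
      using nth_eq_iff_index_eq[of "xs[i := p, j := p]" i j] ij len by auto
  qed (use that in auto)
  let ?a = "xs ! i" and ?b = "xs ! j"
  have "0 = F (?a + ?b) (?a + ?b)"
    using same[OF add[OF T]] by simp
  also have "\<dots> = F ?a (?a + ?b) + F ?b (?a + ?b)"
    by (rule left[OF add[OF T] T])
  also have "\<dots> = F ?a ?b + F ?b ?a"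
    using T by (simp add: right same)
  finally show ?thesis
    by (simp add: F_def)
qed

text \<open>If \<open>xs\<close> repeats an entry, both forms vanish. Otherwise \<open>xs\<close> is a permutation of \<open>es\<close>, and it is
  sorted into \<open>es\<close> by swaps that extend the common prefix one place at a time; each swap changes the
  sign of both values.\<close>

lemma alternating_forms_agree_on_basis_tuples:
  assumes w: "alternating_form (tangent_space n) m w" "alternating_form (tangent_space n) m w'"
    and es: "es \<in> tuples (tangent_space n) m" and eq: "w es = w' es"
    and xs: "length xs = m" "set xs \<subseteq> set es"
  shows "w xs = w' xs"
proof (cases "distinct xs")
  case False
  have "xs \<in> tuples (tangent_space n) m"
    using xs es by (auto simp: tuples_def)
  with False show ?thesis
    using alternating_form_repeated w by metis
next
  case True
  have len: "length es = m"
    using es by (simp add: tuples_def)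
  have "\<lbrakk>length xs = m; set xs \<subseteq> set es; distinct xs; k \<le> m; \<forall>i<k. xs ! i = es ! i\<rbrakk> \<Longrightarrow> w xs = w' xs"
    for k xs
  proof (induction "m - k" arbitrary: k xs)
    case 0
    then have "xs = es"
      using len by (intro nth_equalityI) auto
    then show ?case
      using eq by simp
  next
    case (Suc d)
    then have k: "k < m" by simp
    have xsT: "xs \<in> tuples (tangent_space n) m"
      using Suc.prems es by (auto simp: tuples_def)
    have "card (set es) \<le> card (set xs)"
      using Suc.prems(1,3) len by (metis card_length distinct_card)
    then have sets: "set xs = set es"
      using Suc.prems(2) by (intro card_seteq) auto
    then have dist: "distinct es"
      using Suc.prems(1,3) len by (metis card_distinct distinct_card)
    have "es ! k \<in> set xs"
      using k len sets by simp
    then obtain j where j: "j < m" "xs ! j = es ! k"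
      using Suc.prems(1) by (auto simp: in_set_conv_nth)
    have jk: "k \<le> j"
    proof (rule ccontr)
      assume "\<not> k \<le> j"
      then show False
        using j k len dist Suc.prems(5) by (auto simp: nth_eq_iff_index_eq)
    qed
    show ?case
    proof (cases "j = k")
      case True
      then show ?thesis
        using Suc.hyps Suc.prems j k by (intro Suc.hyps(1)[of "Suc k"]) (auto simp: less_Suc_eq)
    next
      case False
      define ys where "ys = xs[k := xs ! j, j := xs ! k]"
      have "set ys = set xs" "distinct ys = distinct xs"
        unfolding ys_def using Suc.prems(1) j(1) k by (simp_all only: set_swap distinct_swap)
      then have "w ys = w' ys"
        using Suc.hyps Suc.prems j k jk False
        by (intro Suc.hyps(1)[of "Suc k"]) (auto simp: ys_def less_Suc_eq nth_list_update)
      moreover have "w ys = - w xs" "w' ys = - w' xs"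
        unfolding ys_def using alternating_form_swap[OF _ xsT k j(1)] w False by auto
      ultimately show ?thesis by simp
    qed
  qed
  from this[of xs 0] show ?thesis
    using xs True by simp
qed

text \<open>A form of top degree is determined by its value on one basis \<open>es\<close>. The induction frees the first
  \<open>k\<close> entries from the requirement to be basis vectors: entry \<open>k\<close> is expanded in the basis by
  linearity.\<close>

lemma alternating_forms_agree:
  assumes w: "alternating_form (tangent_space n) m w" "alternating_form (tangent_space n) m w'"
    and es: "es \<in> tuples (tangent_space n) m" and eq: "w es = w' es"
    and span: "\<And>y. y \<in> tangent_space n \<Longrightarrow> \<exists>c. y = vec n (\<lambda>i. \<Sum>j<m. c j * es ! j $ i)"
    and xs: "xs \<in> tuples (tangent_space n) m"
  shows "w xs = w' xs"
proof -
  let ?T = "tangent_space n"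
  have len: "length es = m" and esT: "\<And>j. j < m \<Longrightarrow> es ! j \<in> ?T"
    using es by (auto simp: tuples_def)
  have "\<lbrakk>xs \<in> tuples ?T m; k \<le> m; \<forall>i. k \<le> i \<longrightarrow> i < m \<longrightarrow> xs ! i \<in> set es\<rbrakk> \<Longrightarrow> w xs = w' xs" for k xs
  proof (induction k arbitrary: xs)
    case 0
    then have "length xs = m" "set xs \<subseteq> set es"
      by (auto simp: tuples_def in_set_conv_nth)
    then show ?case
      by (rule alternating_forms_agree_on_basis_tuples[OF w es eq])
  next
    case (Suc k)
    note outer_IH = Suc.IH and xsT = Suc.prems(1) and basis_above = Suc.prems(3)
    have k: "k < m"
      using Suc.prems(2) by simp
    have xs_len: "length xs = m"
      using xsT by (simp add: tuples_def)
    have "xs ! k \<in> ?T"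
      using xsT k by (auto simp: tuples_def)
    then obtain c where c: "xs ! k = vec n (\<lambda>i. \<Sum>j<m. c j * es ! j $ i)"
      using span by blast
    define s where "s p = vec n (\<lambda>i. \<Sum>j<p. c j * es ! j $ i)" for p
    have "s p \<in> ?T \<and> w (xs[k := s p]) = w' (xs[k := s p])" if "p \<le> m" for p
      using that
    proof (induction p)
      case 0
      have s0: "s 0 = 0\<^sub>v n"
        by (auto simp: s_def)
      have zero: "v (xs[k := 0\<^sub>v n]) = 0" if "alternating_form ?T m v" for v
        using alternating_form_linear[OF that xsT k tangent_space_zero tangent_space_zero, of 1]
        by simp
      show ?case
        using zero[OF w(1)] zero[OF w(2)] tangent_space_zero by (simp add: s0)
    next
      case (Suc p)
      then have p: "p < m" by simp
      then have "es ! p \<in> carrier_vec n"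
        using esT by (auto simp: tangent_space_def)
      then have s: "s (Suc p) = c p \<cdot>\<^sub>v es ! p + s p"
        by (intro eq_vecI) (auto simp: s_def)
      have IH: "s p \<in> ?T" "w (xs[k := s p]) = w' (xs[k := s p])"
        using Suc by auto
      have "w (xs[k := es ! p]) = w' (xs[k := es ! p])"
        using xsT basis_above p k esT len xs_len
        by (intro outer_IH) (auto simp: tuples_update nth_list_update)
      then show ?case
        unfolding s alternating_form_linear[OF w(1) xsT k esT[OF p] IH(1)]
          alternating_form_linear[OF w(2) xsT k esT[OF p] IH(1)]
        using IH tangent_space_combine[OF esT[OF p] IH(1)] by simp
    qed
    moreover have "s m = xs ! k"
      unfolding s_def by (rule c[symmetric])
    ultimately show ?case
      by (metis list_update_id order_refl)
  qed
  from this[of xs m] show ?thesis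
    using xs by simp
qed

section \<open>The volume form of a metric given by a matrix\<close>

lemma unit_normal_carrier: "unit_normal n \<in> carrier_vec n"
  by (simp add: unit_normal_def)

lemma unit_normal_unit: "0 < n \<Longrightarrow> unit_normal n \<bullet> unit_normal n = 1"
  by (simp add: unit_normal_def scalar_prod_def field_simps)

lemma tangent_space_iff_orthogonal:
  assumes "0 < n"
  shows "\<tau> \<in> tangent_space n \<longleftrightarrow> \<tau> \<in> carrier_vec n \<and> unit_normal n \<bullet> \<tau> = 0"
proof -
  have "unit_normal n \<bullet> \<tau> = (\<Sum>i<n. \<tau> $ i) / sqrt (real n)" if "\<tau> \<in> carrier_vec n"
    using that by (simp add: unit_normal_def scalar_prod_def sum_divide_distrib atLeast0LessThan)
  then show ?thesis
    using assms by (auto simp: tangent_space_def)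
qed

lemma gram_matrix_det:
  fixes P :: "real mat"
  assumes "P \<in> carrier_mat n n" "X \<in> carrier_mat n n" "transpose_mat X * P * X = 1\<^sub>m n"
  shows "(det X)\<^sup>2 * det P = 1"
proof -
  have "det (transpose_mat X * P * X) = det X * det P * det X"
    using assms(1,2) by (simp add: det_mult[of _ n] det_transpose[of X n])
  then show ?thesis
    using assms(3) by (simp add: power2_eq_square mult_ac)
qed

text \<open>Negating column 1 corrects the orientation and leaves the normal in column 0.\<close>

lemma positively_oriented_frame:
  fixes P :: "real mat"
  assumes n: "0 < n" and P: "P \<in> carrier_mat n n"
    and M: "M \<in> carrier_mat n n" and M0: "col M 0 = unit_normal n"
    and orth: "transpose_mat M * P * M = 1\<^sub>m n"
  shows "\<exists>N\<in>carrier_mat n n. col N 0 = unit_normal n \<and> transpose_mat N * P * N = 1\<^sub>m n \<and> 0 < det N"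
proof (cases "0 < det M")
  case True
  then show ?thesis
    using M M0 orth by blast
next
  case False
  moreover have "det M \<noteq> 0"
    using gram_matrix_det[OF P M orth] by auto
  ultimately have neg: "det M < 0"
    by simp
  \<comment> \<open>In dimension one there is no such column, but then \<open>M\<close> is the positive number \<open>u\<^sub>0\<close>.\<close>
  have n1: "1 < n"
  proof (rule ccontr)
    assume "\<not> 1 < n"
    then have n1: "n = 1" using n by simp
    have "det M = M $$ (0, 0)"
      using M by (intro det_single) (simp add: n1)
    also have "\<dots> = col M 0 $ 0"
      using M n by simp
    finally show False
      using neg M0 n1 by (simp add: unit_normal_def)
  qed
  define S where "S = mat_diag n (\<lambda>i. if i = 1 then - 1 else 1 :: real)"
  have S: "S \<in> carrier_mat n n" and St: "transpose_mat S = S"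
    by (simp_all add: S_def transpose_mat_diag)
  have SS: "S * S = 1\<^sub>m n"
    unfolding S_def by (simp flip: mat_diag_one) (rule arg_cong[of _ _ "mat_diag n"], auto)
  have "det S = (\<Prod>i<n. if i = 1 then - 1 else 1)"
    unfolding S_def by (rule det_mat_diag)
  also have "\<dots> = - 1"
    using n1 by simp
  finally have detS: "det S = - 1" .
  have Mt: "transpose_mat M \<in> carrier_mat n n"
    using M by simp
  have "transpose_mat (M * S) * P * (M * S) = S * (transpose_mat M * P * M) * S"
    using M Mt S P by (simp add: transpose_mult[OF M S] St assoc_mult_mat[of _ n n _ n _ n])
  then have "transpose_mat (M * S) * P * (M * S) = 1\<^sub>m n"
    using S SS by (simp add: orth)
  moreover have "col (M * S) 0 = col M 0"
    using M n by (intro eq_vecI) (auto simp: S_def mat_diag_mult_right[OF M])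
  moreover have "0 < det (M * S)"
    using det_mult[OF M S] neg detS by simp
  ultimately show ?thesis
    using mult_carrier_mat[OF M S] M0 by metis
qed

text \<open>Let \<open>X\<close> be the matrix with columns \<open>u\<^sub>0\<close> and a \<open>g\<close>-orthonormal basis of the tangent space. As \<open>P\<close>
  is symmetric and fixes \<open>u\<^sub>0\<close>, the normal has length 1 with respect to \<open>P\<close> and is orthogonal to the
  tangent vectors, so \<open>X\<^sup>T P X = 1\<close> and \<open>(det X)\<^sup>2 det P = 1\<close>. Hence \<open>sqrt (det P)\<close> times the Euclidean form
  is \<open>1\<close> on every positive orthonormal basis.

  The matrix \<open>M\<close> provides at least one orthonormal basis, of either orientation. It is what makes the
  description of the volume form unique.\<close>

lemma volume_form_eq_normal_det:
  fixes P :: "real mat"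
  assumes n: "0 < n" and P: "P \<in> carrier_mat n n" and sym: "transpose_mat P = P"
    and normal: "P *\<^sub>v unit_normal n = unit_normal n"
    and M: "M \<in> carrier_mat n n" and M0: "col M 0 = unit_normal n"
    and orth: "transpose_mat M * P * M = 1\<^sub>m n"
    and g: "\<And>\<sigma> \<tau>. \<sigma> \<in> tangent_space n \<Longrightarrow> \<tau> \<in> tangent_space n \<Longrightarrow> g \<rho> \<sigma> \<tau> = \<sigma> \<bullet> (P *\<^sub>v \<tau>)"
    and xs: "xs \<in> tuples (tangent_space n) (n - 1)"
  shows "volume_form n g \<rho> xs = sqrt (det P) * normal_det n xs"
proof -
  let ?T = "tangent_space n" and ?u = "unit_normal n"
  note u = unit_normal_carrier[of n]
  have Pt: "?u \<bullet> (P *\<^sub>v \<tau>) = ?u \<bullet> \<tau>" if "\<tau> \<in> carrier_vec n" for \<tau>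
    using transpose_vec_mult_scalar[OF P that u] by (simp add: sym normal)
  note det = gram_matrix_det[OF P]
  have "0 < (det M)\<^sup>2 * det P"
    using det[OF M orth] by simp
  then have detP: "0 < det P"
    by (simp add: zero_less_mult_iff)
  have det_pos: "sqrt (det P) * det X = 1"
    if "X \<in> carrier_mat n n" "transpose_mat X * P * X = 1\<^sub>m n" "0 < det X" for X
  proof -
    have "(sqrt (det P) * det X)\<^sup>2 = 1"
      using det[OF that(1,2)] detP by (simp add: power_mult_distrib mult.commute)
    moreover have "0 < sqrt (det P) * det X"
      using that(3) detP by simp
    ultimately show ?thesis
      unfolding power2_eq_1_iff by linarith
  qed
  from positively_oriented_frame[OF n P M M0 orth]
  obtain N where N: "N \<in> carrier_mat n n" and N0: "col N 0 = ?u"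
    and orthN: "transpose_mat N * P * N = 1\<^sub>m n" and posN: "0 < det N"
    by blast
  have cN: "col N i \<in> carrier_vec n" if "i < n" for i
    using N that by simp
  define es where "es = map (\<lambda>j. col N (Suc j)) [0..<n - 1]"
  have es_nth: "es ! j = col N (Suc j)" if "j < n - 1" for j
    using that by (simp add: es_def)
  have es_len: "length es = n - 1"
    by (simp add: es_def)
  have es_cols: "mat_of_cols n (?u # es) = N"
  proof (rule eq_matI)
    fix i j assume "i < dim_row N" "j < dim_col N"
    then have ij: "i < n" "j < n" using N by auto
    show "mat_of_cols n (?u # es) $$ (i, j) = N $$ (i, j)"
    proof (cases j)
      case 0
      have "?u $ i = col N 0 $ i" by (simp add: N0)
      then show ?thesis
        using 0 ij N by (simp add: mat_of_cols_Cons_index_0)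
    next
      case (Suc k)
      then show ?thesis
        using ij N by (simp add: mat_of_cols_index es_nth es_len)
    qed
  next
    show "dim_row (mat_of_cols n (?u # es)) = dim_row N" "dim_col (mat_of_cols n (?u # es)) = dim_col N"
      using carrier_matD[OF N] n by (simp_all add: es_len)
  qed
  have es_orth: "col N i \<bullet> (P *\<^sub>v col N j) = (if i = j then 1 else 0)" if "i < n" "j < n" for i j
    using index_triple_product[OF P N that] that unfolding orthN by simp
  have "col N (Suc j) \<in> ?T" if "j < n - 1" for j
    using that es_orth[of 0 "Suc j"] Pt[OF cN[of "Suc j"]] cN n
    by (simp add: tangent_space_iff_orthogonal[OF n] N0)
  then have es: "es \<in> tuples ?T (n - 1)"
    by (auto simp: tuples_def es_def)
  have es_orthonormal: "orthonormal_wrt (g \<rho>) es"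
    unfolding orthonormal_wrt_def
  proof (intro allI impI)
    fix i j assume "i < length es" "j < length es"
    then have ij: "i < n - 1" "j < n - 1"
      by (auto simp: es_def)
    then have "es ! i \<in> ?T" "es ! j \<in> ?T"
      using es by (auto simp: tuples_def)
    then show "g \<rho> (es ! i) (es ! j) = (if i = j then 1 else 0)"
      using ij es_orth[of "Suc i" "Suc j"] by (simp add: g es_nth)
  qed
  have span: "\<exists>c. y = vec n (\<lambda>i. \<Sum>j<n - 1. c j * es ! j $ i)" if y: "y \<in> ?T" for y
  proof -
    have yc: "y \<in> carrier_vec n" and uy: "?u \<bullet> y = 0"
      using y by (auto simp: tangent_space_iff_orthogonal[OF n])
    \<comment> \<open>The inverse of \<open>N\<close> is \<open>N\<^sup>T P\<close>, so these are the coordinates of \<open>y\<close> in the columns of \<open>N\<close>.\<close>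
    define c where "c = (transpose_mat N * P) *\<^sub>v y"
    have NP: "transpose_mat N * P \<in> carrier_mat n n"
      using N P by simp
    have cc: "c \<in> carrier_vec n"
      using NP yc by (simp add: c_def)
    have "N * (transpose_mat N * P) = 1\<^sub>m n"
      by (rule mat_mult_left_right_inverse[OF NP N orthN])
    then have Nc: "N *\<^sub>v c = y"
      using assoc_mult_mat_vec[OF N NP yc] yc by (simp add: c_def)
    have "c $ 0 = col N 0 \<bullet> (P *\<^sub>v y)"
      using N P yc n by (simp add: c_def assoc_mult_mat_vec[of _ n n _ n])
    then have c0: "c $ 0 = 0"
      using Pt[OF yc] uy by (simp add: N0)
    have "y = vec n (\<lambda>i. \<Sum>j<n - 1. c $ Suc j * es ! j $ i)"
    proof (rule eq_vecI)
      fix i assume "i < dim_vec (vec n (\<lambda>i. \<Sum>j<n - 1. c $ Suc j * es ! j $ i))"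
      then have i: "i < n" by simp
      have "y $ i = (\<Sum>j<n. N $$ (i, j) * c $ j)"
        using i N cc by (simp add: Nc[symmetric] scalar_prod_def atLeast0LessThan)
      also have "\<dots> = (\<Sum>j<Suc (n - 1). N $$ (i, j) * c $ j)"
        using n by simp
      also have "\<dots> = (\<Sum>j<n - 1. N $$ (i, Suc j) * c $ Suc j)"
        by (subst sum.lessThan_Suc_shift) (simp add: c0)
      also have "\<dots> = (\<Sum>j<n - 1. c $ Suc j * es ! j $ i)"
        using i N by (intro sum.cong) (auto simp: es_nth)
      finally show "y $ i = vec n (\<lambda>i. \<Sum>j<n - 1. c $ Suc j * es ! j $ i) $ i"
        using i by simp
    qed (use yc in simp)
    then show ?thesis by (rule exI[of _ "\<lambda>j. c $ Suc j"])
  qed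
  define w0 where "w0 = restrict (\<lambda>xs. sqrt (det P) * normal_det n xs) (tuples ?T (n - 1))"
  have alt0: "alternating_form ?T (n - 1) w0"
    unfolding w0_def by (rule normal_det_alternating)
  have one0: "w0 fs = 1"
    if fs: "fs \<in> tuples ?T (n - 1)" "orthonormal_wrt (g \<rho>) fs" "positively_oriented n fs" for fs
  proof -
    define X where "X = mat_of_cols n (?u # fs)"
    have len: "length fs = n - 1" and fsT: "\<And>j. j < n - 1 \<Longrightarrow> fs ! j \<in> ?T"
      using fs(1) by (auto simp: tuples_def)
    have X: "X \<in> carrier_mat n n"
      unfolding X_def using len n by (intro carrier_matI) auto
    have X0: "col X 0 = ?u"
      using u by (simp add: X_def)
    have XS: "col X (Suc j) = fs ! j" if "j < n - 1" for j
      using fsT[OF that] that len by (simp add: X_def tangent_space_def)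
    have "transpose_mat X * P * X = 1\<^sub>m n"
    proof (rule eq_matI)
      fix i j assume "i < dim_row (1\<^sub>m n :: real mat)" "j < dim_col (1\<^sub>m n :: real mat)"
      then have ij: "i < n" "j < n" by auto
      have fsu: "fs ! k \<bullet> ?u = 0" "?u \<bullet> (P *\<^sub>v fs ! k) = 0" if "k < n - 1" for k
        using fsT[OF that] comm_scalar_prod[OF u, of "fs ! k"] Pt
        by (auto simp: tangent_space_iff_orthogonal[OF n])
      have "col X i \<bullet> (P *\<^sub>v col X j) = (if i = j then 1 else 0)"
      proof (cases i; cases j)
        fix k l assume "i = Suc k" "j = Suc l"
        then show ?thesis
          using ij fs(2) g[OF fsT fsT, of k l] len by (auto simp: XS orthonormal_wrt_def)
      qed (use ij fsu in \<open>auto simp: X0 XS normal unit_normal_unit[OF n]\<close>)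
      then show "(transpose_mat X * P * X) $$ (i, j) = 1\<^sub>m n $$ (i, j)"
        using index_triple_product[OF P X ij] ij by simp
    qed (use X P in auto)
    then have "sqrt (det P) * det X = 1"
      using fs(3) by (intro det_pos[OF X]) (auto simp: X_def positively_oriented_def)
    then show ?thesis
      using fs(1) by (simp add: w0_def normal_det_def X_def)
  qed
  have es_pos: "positively_oriented n es"
    using posN by (simp add: positively_oriented_def es_cols)
  have "volume_form n g \<rho> = w0"
    unfolding volume_form_def
  proof (rule the_equality)
    show "alternating_form ?T (n - 1) w0 \<and> (\<forall>es\<in>tuples ?T (n - 1).
        orthonormal_wrt (g \<rho>) es \<longrightarrow> positively_oriented n es \<longrightarrow> w0 es = 1)"
      using alt0 one0 by blast
  next
    fix w assume w: "alternating_form ?T (n - 1) w \<and> (\<forall>es\<in>tuples ?T (n - 1).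
        orthonormal_wrt (g \<rho>) es \<longrightarrow> positively_oriented n es \<longrightarrow> w es = 1)"
    then have "w es = w0 es"
      using es es_orthonormal es_pos one0 by simp
    then have "w ys = w0 ys" if "ys \<in> tuples ?T (n - 1)" for ys
      using alternating_forms_agree[OF _ alt0 es _ span that] w by blast
    moreover have "w \<in> extensional (tuples ?T (n - 1))" "w0 \<in> extensional (tuples ?T (n - 1))"
      using w alt0 by (auto simp: alternating_form_def)
    ultimately show "w = w0"
      by (intro extensionalityI)
  qed
  then show ?thesis
    using xs by (simp add: w0_def)
qed

section \<open>The weighted graph Laplacian\<close>

context connected_weighted_graph
begin

lemma laplacian_carrier: "laplacian n E \<omega> a \<in> carrier_mat n n"
  by (simp add: laplacian_def)

lemma laplacian_symmetric: "transpose_mat (laplacian n E \<omega> a) = laplacian n E \<omega> a"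
  using undirected weight_sym
  by (intro eq_matI) (auto simp: laplacian_def neighbours_def edge_mean_def add.commute dest: symD)

lemma laplacian_unit_normal: "laplacian n E \<omega> a *\<^sub>v unit_normal n = 0\<^sub>v n"
proof (rule eq_vecI)
  fix i assume "i < dim_vec (0\<^sub>v n :: real vec)"
  then have i: "i < n" by simp
  have "(laplacian n E \<omega> a *\<^sub>v unit_normal n) $ i =
      (\<Sum>j\<in>neighbours E i. \<omega> i j * edge_mean a i j * (unit_normal n $ i - unit_normal n $ j))"
    by (rule laplacian_mult_vec[OF edges _ i]) (simp add: unit_normal_def)
  also have "\<dots> = 0"
    using edges i by (intro sum.neutral) (auto simp: neighbours_def unit_normal_def)
  finally show "(laplacian n E \<omega> a *\<^sub>v unit_normal n) $ i = 0\<^sub>v n $ i"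
    using i by simp
qed (simp add: laplacian_def)

text \<open>Symmetrizing the sum over edges turns \<open>\<sigma> \<bullet> L \<sigma>\<close> into half the Dirichlet form
  \<open>\<Sum>\<^sub>i \<Sum>\<^sub>j c i j (\<sigma>\<^sub>i - \<sigma>\<^sub>j)\<^sup>2\<close>, whose coefficients are positive on the edges since \<open>\<rho>\<close> is positive. If it
  vanishes, \<open>\<sigma>\<close> is constant by connectedness, and a constant of sum zero is zero.\<close>

lemma laplacian_positive_on_tangent_space:
  assumes \<rho>: "\<rho> \<in> positive_simplex n" and \<sigma>: "\<sigma> \<in> tangent_space n" "\<sigma> \<noteq> 0\<^sub>v n"
  shows "0 < \<sigma> \<bullet> (laplacian n E \<omega> \<rho> *\<^sub>v \<sigma>)"
proof -
  define c where "c i j = (if (i, j) \<in> E then \<omega> i j * edge_mean \<rho> i j else 0)" for i j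
  have c_pos: "0 < c i j" if "(i, j) \<in> E" for i j
    using that edges \<rho> weight_pos[OF that] by (auto simp: c_def edge_mean_def positive_simplex_def intro!: mult_pos_pos add_pos_pos)
  have c_nonneg: "0 \<le> c i j" for i j
    using c_pos[of i j] by (cases "(i, j) \<in> E") (auto simp: c_def)
  have c_sym: "c i j = c j i" if "i < n" "j < n" for i j
    using that undirected weight_sym by (auto simp: c_def edge_mean_def add.commute dest: symD)
  have \<sigma>c: "\<sigma> \<in> carrier_vec n"
    using \<sigma> by (simp add: tangent_space_def)
  have L: "(laplacian n E \<omega> \<rho> *\<^sub>v \<sigma>) $ i = (\<Sum>j<n. c i j * (\<sigma> $ i - \<sigma> $ j))" if i: "i < n" for i
  proof -
    have "(\<Sum>j\<in>neighbours E i. \<omega> i j * edge_mean \<rho> i j * (\<sigma> $ i - \<sigma> $ j)) =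
        (\<Sum>j<n. c i j * (\<sigma> $ i - \<sigma> $ j))"
      using edges i by (intro sum.mono_neutral_cong_left) (auto simp: neighbours_def c_def)
    then show ?thesis
      by (simp only: laplacian_mult_vec[OF edges \<sigma>c i])
  qed
  define Q where "Q = \<sigma> \<bullet> (laplacian n E \<omega> \<rho> *\<^sub>v \<sigma>)"
  have Q: "Q = (\<Sum>i<n. \<Sum>j<n. c i j * (\<sigma> $ i * (\<sigma> $ i - \<sigma> $ j)))"
  proof -
    have "Q = (\<Sum>i<n. \<sigma> $ i * (laplacian n E \<omega> \<rho> *\<^sub>v \<sigma>) $ i)"
      unfolding Q_def using laplacian_carrier[of \<rho>]
      by (simp add: scalar_prod_def atLeast0LessThan carrier_matD del: index_mult_mat_vec)
    then show ?thesis
      by (simp add: L sum_distrib_left mult_ac del: index_mult_mat_vec)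
  qed
  also have "\<dots> = (\<Sum>j<n. \<Sum>i<n. c i j * (\<sigma> $ i * (\<sigma> $ i - \<sigma> $ j)))"
    by (rule sum.swap)
  also have "\<dots> = (\<Sum>i<n. \<Sum>j<n. c i j * (\<sigma> $ j * (\<sigma> $ j - \<sigma> $ i)))"
    by (intro sum.cong refl) (simp add: c_sym)
  finally have "Q + Q = (\<Sum>i<n. \<Sum>j<n. c i j * (\<sigma> $ i * (\<sigma> $ i - \<sigma> $ j)) + c i j * (\<sigma> $ j * (\<sigma> $ j - \<sigma> $ i)))"
    using Q by (simp add: sum.distrib)
  also have "\<dots> = (\<Sum>i<n. \<Sum>j<n. c i j * (\<sigma> $ i - \<sigma> $ j)\<^sup>2)"
    by (intro sum.cong refl) (simp add: power2_eq_square algebra_simps)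
  finally have dirichlet: "Q + Q = (\<Sum>i<n. \<Sum>j<n. c i j * (\<sigma> $ i - \<sigma> $ j)\<^sup>2)" .
  have "Q \<noteq> 0"
  proof
    assume "Q = 0"
    then have zero: "(\<Sum>i<n. \<Sum>j<n. c i j * (\<sigma> $ i - \<sigma> $ j)\<^sup>2) = 0"
      using dirichlet by simp
    have edge: "\<sigma> $ i = \<sigma> $ j" if ij: "(i, j) \<in> E" for i j
    proof -
      have "(\<Sum>j<n. c i j * (\<sigma> $ i - \<sigma> $ j)\<^sup>2) = 0"
        using zero ij edges by (subst (asm) sum_nonneg_eq_0_iff) (auto intro!: sum_nonneg mult_nonneg_nonneg c_nonneg)
      then have "c i j * (\<sigma> $ i - \<sigma> $ j)\<^sup>2 = 0"
        using ij edges by (subst (asm) sum_nonneg_eq_0_iff) (auto intro!: mult_nonneg_nonneg c_nonneg)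
      then show ?thesis
        using c_pos[OF ij] by simp
    qed
    have "\<sigma> $ i = \<sigma> $ j" if "(i, j) \<in> E\<^sup>*" for i j
      using that by induction (auto dest: edge)
    then have const: "\<sigma> $ i = \<sigma> $ 0" if "i < n" for i
      using connected[OF that n_pos] by blast
    have "(\<Sum>i<n. \<sigma> $ i) = (\<Sum>i<n. \<sigma> $ 0)"
      by (intro sum.cong refl const) simp
    then have zero0: "\<sigma> $ 0 = 0"
      using \<sigma>(1) n_pos by (simp add: tangent_space_def)
    have "\<sigma> = 0\<^sub>v n"
    proof (rule eq_vecI)
      fix i assume "i < dim_vec (0\<^sub>v n :: real vec)"
      then show "\<sigma> $ i = 0\<^sub>v n $ i"
        using const[of i] zero0 by simp
    qed (use \<sigma>c in simp)
    then show False
      using \<sigma>(2) by simp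
  qed
  moreover have "0 \<le> Q + Q"
    unfolding dirichlet by (intro sum_nonneg mult_nonneg_nonneg c_nonneg) simp
  ultimately show ?thesis
    unfolding Q_def by linarith
qed

lemma laplacian_spectral_decomposition:
  assumes \<rho>: "\<rho> \<in> positive_simplex n"
  shows "\<exists>U f. orthogonal_matrix n U \<and> laplacian n E \<omega> \<rho> = from_spectrum U f \<and>
    col U 0 = unit_normal n \<and> f 0 = 0 \<and> (\<forall>i<n. i \<noteq> 0 \<longrightarrow> 0 < f i)"
proof -
  let ?L = "laplacian n E \<omega> \<rho>" and ?u = "unit_normal n"
  have "?L *\<^sub>v ?u = 0 \<cdot>\<^sub>v ?u"
    unfolding laplacian_unit_normal using unit_normal_carrier[of n] by (intro eq_vecI) auto
  from spectral_theorem_with_eigenvector[OF laplacian_carrier laplacian_symmetric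
      unit_normal_carrier unit_normal_unit[OF n_pos] this]
  obtain U f where U: "U \<in> carrier_mat n n" "transpose_mat U * U = 1\<^sub>m n"
    and L: "?L = U * mat_diag n f * transpose_mat U" and U0: "col U 0 = ?u" and f0: "f 0 = 0"
    by blast
  interpret orthogonal_matrix n U
    using U by unfold_locales
  have L': "?L = from_spectrum U f"
    using L U(1) by (simp only: from_spectrum_def carrier_matD)
  have gram: "col U i \<bullet> col U j = (if i = j then 1 else 0)" if "i < n" "j < n" for i j
  proof -
    have "col U i \<bullet> col U j = (transpose_mat U * U) $$ (i, j)"
      using that U(1) by simp
    then show ?thesis
      using that unfolding orthonormal_columns by simp
  qed
  have "0 < f i" if i: "i < n" "i \<noteq> 0" for i
  proof -
    have "col U i \<in> tangent_space n"
      using gram[OF n_pos i(1)] i U(1) by (simp add: tangent_space_iff_orthogonal[OF n_pos] U0)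
    moreover have "col U i \<noteq> 0\<^sub>v n"
      using gram[OF i(1) i(1)] by auto
    ultimately have "0 < col U i \<bullet> (?L *\<^sub>v col U i)"
      by (rule laplacian_positive_on_tangent_space[OF \<rho>])
    also have "\<dots> = mat_diag n f $$ (i, i)"
      using index_triple_product[OF laplacian_carrier[of \<rho>] U(1) i(1) i(1)]
      unfolding L' diagonalize_from_spectrum by simp
    finally show ?thesis
      using i by (simp add: mat_diag_def)
  qed
  then show ?thesis
    using L' U0 f0 orthogonal_matrix_axioms by blast
qed

end

section \<open>The Wasserstein volume form\<close>

theorem theorem3:
  fixes n :: nat
    and E :: "(nat \<times> nat) set"
    and \<omega> :: "nat \<Rightarrow> nat \<Rightarrow> real"
    and \<rho> :: "real vec"
    and \<sigma>s :: "real vec list"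
  assumes "connected_weighted_graph n E \<omega>"
    and "\<rho> \<in> positive_simplex n"
    and "\<sigma>s \<in> tuples (tangent_space n) (n - 1)"
  shows "volume_form n (wasserstein_metric n E \<omega>) \<rho> \<sigma>s =
    prod_positive_eigenvalues (laplacian n E \<omega> \<rho>) powr (- 1 / 2) *
    volume_form n euclidean_metric \<rho> \<sigma>s"
proof -
  interpret connected_weighted_graph n E \<omega>
    by (rule assms(1))
  let ?u = "unit_normal n" and ?L = "laplacian n E \<omega> \<rho>"
  obtain U f where "orthogonal_matrix n U" and L: "?L = from_spectrum U f"
    and U0: "col U 0 = ?u" and f0: "f 0 = 0" and f_pos: "\<And>i. i < n \<Longrightarrow> i \<noteq> 0 \<Longrightarrow> 0 < f i"
    using laplacian_spectral_decomposition[OF assms(2)] by blast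
  then interpret orthogonal_matrix n U by simp
  \<comment> \<open>On the tangent space \<open>P\<close> acts as the pseudo-inverse of \<open>L\<close>; its eigenvalue at the normal is raised
    from 0 to 1.\<close>
  define h where "h i = (if i = 0 then 1 else inverse (f i))" for i
  define k where "k i = (if i = 0 then 1 else sqrt (f i))" for i
  define P where "P = from_spectrum U h"
  have P: "P \<in> carrier_mat n n" and P_sym: "transpose_mat P = P"
    unfolding P_def by (rule from_spectrum_carrier transpose_from_spectrum)+
  have gram: "col U i \<bullet> ?u = 0" if "i < n" "i \<noteq> 0" for i
  proof -
    have "col U i \<bullet> ?u = (transpose_mat U * U) $$ (i, 0)"
      using that U n_pos by (simp add: U0)
    then show ?thesis
      using that n_pos unfolding orthonormal_columns by simp
  qed
  have "P *\<^sub>v ?u = from_spectrum U (\<lambda>_. 1) *\<^sub>v ?u"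
    unfolding P_def using gram
    by (intro from_spectrum_mult_vec_cong[OF unit_normal_carrier]) (auto simp: h_def)
  also have "from_spectrum U (\<lambda>_. 1) = 1\<^sub>m n"
    using U orthonormal_rows by (simp add: from_spectrum_def)
  finally have P_normal: "P *\<^sub>v ?u = ?u"
    using unit_normal_carrier[of n] by simp
  \<comment> \<open>A unit eigenvector of \<open>L\<close> for \<open>\<lambda> > 0\<close> has \<open>g\<^sub>W\<close>-norm \<open>\<lambda> powr (- 1 / 2)\<close>; the factor \<open>sqrt \<lambda>\<close>
    normalizes it.\<close>
  define M where "M = U * mat_diag n k"
  have M: "M \<in> carrier_mat n n"
    unfolding M_def by (rule factor_carriers)
  have M0: "col M 0 = ?u"
    unfolding U0[symmetric] M_def mat_diag_mult_right[OF U]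
    using U n_pos by (intro eq_vecI) (auto simp: k_def)
  have Mt: "transpose_mat M = mat_diag n k * transpose_mat U"
    unfolding M_def using transpose_mult[OF U mat_diag_dim] by (simp add: transpose_mat_diag)
  have "transpose_mat M * P * M = mat_diag n k * (transpose_mat U * P * U) * mat_diag n k"
    unfolding Mt unfolding M_def using U U_transpose_carrier P mat_diag_dim[of n k]
    by (simp add: assoc_mult_mat[of _ n n _ n _ n] mult_carrier_mat[of _ n n _ n])
  also have "\<dots> = mat_diag n (\<lambda>i. k i * h i * k i)"
    unfolding P_def diagonalize_from_spectrum by simp
  also have "\<dots> = mat_diag n (\<lambda>_. 1)"
  proof -
    have "k i * h i * k i = 1" if "i < n" for i
      using f_pos[OF that] by (cases "i = 0") (auto simp: k_def h_def field_simps)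
    then show ?thesis
      unfolding mat_diag_def by (intro cong_mat) auto
  qed
  finally have M_orth: "transpose_mat M * P * M = 1\<^sub>m n"
    by simp
  have metric: "wasserstein_metric n E \<omega> \<rho> \<sigma> \<tau> = \<sigma> \<bullet> (P *\<^sub>v \<tau>)"
    if "\<sigma> \<in> tangent_space n" "\<tau> \<in> tangent_space n" for \<sigma> \<tau>
  proof -
    have "\<tau> \<in> carrier_vec n" "?u \<bullet> \<tau> = 0"
      using that(2) by (auto simp: tangent_space_iff_orthogonal[OF n_pos])
    then have "from_spectrum U (\<lambda>i. inverse (f i)) *\<^sub>v \<tau> = P *\<^sub>v \<tau>"
      unfolding P_def using U0 by (intro from_spectrum_mult_vec_cong) (auto simp: h_def)
    then show ?thesis
      by (simp add: wasserstein_metric_def L pseudo_inverse_from_spectrum)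
  qed
  have W: "volume_form n (wasserstein_metric n E \<omega>) \<rho> \<sigma>s = sqrt (det P) * normal_det n \<sigma>s"
    using metric by (intro volume_form_eq_normal_det[OF n_pos P P_sym P_normal M M0 M_orth _ assms(3)])
  have one: "transpose_mat U * 1\<^sub>m n * U = 1\<^sub>m n"
    using U orthonormal_columns by simp
  have "volume_form n euclidean_metric \<rho> \<sigma>s = sqrt (det (1\<^sub>m n)) * normal_det n \<sigma>s"
    using unit_normal_carrier[of n]
    by (intro volume_form_eq_normal_det[OF n_pos _ _ _ U U0 one _ assms(3)])
       (auto simp: euclidean_metric_def tangent_space_def)
  then have eucl: "volume_form n euclidean_metric \<rho> \<sigma>s = normal_det n \<sigma>s"
    by simp
  have pos: "{i. i < n \<and> 0 < f i} = {..<n} - {0}"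
    using f_pos f0 by auto
  have eig: "prod_positive_eigenvalues ?L = (\<Prod>i\<in>{..<n} - {0}. f i)"
    unfolding L prod_positive_eigenvalues_from_spectrum pos ..
  have "0 < prod_positive_eigenvalues ?L"
    unfolding eig using f_pos by (intro prod_pos) auto
  moreover have "det P = inverse (prod_positive_eigenvalues ?L)"
  proof -
    have "det P = h 0 * (\<Prod>i\<in>{..<n} - {0}. h i)"
      unfolding P_def det_from_spectrum using n_pos by (intro prod.remove) auto
    also have "\<dots> = (\<Prod>i\<in>{..<n} - {0}. inverse (f i))"
      by (simp add: h_def)
    finally show ?thesis
      by (simp add: eig prod_inversef[symmetric] o_def)
  qed
  ultimately have "sqrt (det P) = prod_positive_eigenvalues ?L powr (- 1 / 2)"
    by (simp add: powr_minus powr_half_sqrt real_sqrt_inverse)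
  then show ?thesis
    by (simp add: W eucl)
qed

end
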